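(* Let $N\ge 2$ and let $A$ be a simple, connected, undirected graph on the vertices $\{1,\dots,N\}$. For each vertex $i$ let $\mathcal{N}_i$ be its set of neighbors and $d_i=|\mathcal{N}_i|$ its degree, and put $d_{\max}=\max\{d_1,\dots,d_N\}$. Let $\varepsilon\ge 0$ and consider on $\mathbb{T}^N=(\mathbb{R}/2\pi\mathbb{Z})^N$ the system of ordinary differential equations $$\dot\theta_i=\left(1-\varepsilon Z_i^2\right)\sum_{j\in\mathcal{N}_i}\sin(\theta_j-\theta_i),\qquad i=1,\dots,N,$$ where $$Z_i=\left|\sum_{j\in\mathcal{N}_i}e^{\mathrm{i}\theta_j}\right|.$$ If $\varepsilon<\varepsilon_c:=1/d_{\max}^2$, then the fully synchronized state $R=1$, that is, the set $\{\theta\in\mathbb{T}^N: R(\theta)=1\}=\{\theta\in\mathbb{T}^N:\theta_1=\dots=\theta_N\}$, is Lyapunov stable for this system.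
   Context: The norm of the global order parameter is $R(\theta)=\left|\frac1N\sum_{i=1}^N e^{\mathrm{i}\theta_i}\right|\in[0,1]$; the fully synchronized state is $R=1$, equivalently $\theta_1=\dots=\theta_N$ in $\mathbb{R}/2\pi\mathbb{Z}$. Here $\mathrm{i}$ in exponents is the imaginary unit. Lyapunov stability of the synchronized state $S=\{\theta\in\mathbb{T}^N: R(\theta)=1\}$ is understood as stability of this set: for every neighborhood $V$ of $S$ in $\mathbb{T}^N$ there is a neighborhood $W$ of $S$ such that every solution with $\theta(0)\in W$ satisfies $\theta(t)\in V$ for all $t\ge 0$. *)

theory Defs
  imports "HOL-Analysis.Analysis" "HOL-Library.Real_Mod" "Graph_Theory.Graph_Theory"
begin

text \<open>A point of \<open>\<real>/2\<pi>\<int>\<close> is a congruence class of reals modulo \<open>2\<pi>\<close>.\<close>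

definition angle_class :: "real \<Rightarrow> real set" where
  "angle_class x = {y. [x = y] (rmod (2 * pi))}"

definition circle :: "real set topology" where
  "circle = topology (\<lambda>U. U \<subseteq> range angle_class \<and> open (angle_class -` U))"

text \<open>Points of the torus are functions on \<open>{1..N}\<close> that are \<open>undefined\<close> elsewhere.\<close>

definition torus :: "nat \<Rightarrow> (nat \<Rightarrow> real set) topology" where
  "torus N = product_topology (\<lambda>_. circle) {1..N}"

lemma openin_circle:
  "openin circle U \<longleftrightarrow> U \<subseteq> range angle_class \<and> open (angle_class -` U)"
proof -
  have "istopology (\<lambda>U. U \<subseteq> range angle_class \<and> open (angle_class -` U))"
    unfolding istopology_def
  proof (intro conjI allI impI)
    fix K assume K: "\<forall>S\<in>K. S \<subseteq> range angle_class \<and> open (angle_class -` S)"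
    then show "\<Union>K \<subseteq> range angle_class" by blast
    from K show "open (angle_class -` \<Union>K)"
      by (subst vimage_Union) blast
  qed auto
  then show ?thesis unfolding circle_def by simp
qed

lemma quotient_map_angle_class: "quotient_map euclideanreal circle angle_class"
proof -
  have "topspace circle = range angle_class"
  proof
    show "topspace circle \<subseteq> range angle_class"
      using openin_circle[of "topspace circle"] by simp
    have "openin circle (range angle_class)"
      by (auto simp: openin_circle vimage_def)
    then show "range angle_class \<subseteq> topspace circle" by (rule openin_subset)
  qed
  then show ?thesis
    by (auto simp: quotient_map_def openin_circle vimage_def)
qed

text \<open>An arbitrary representative of a class. It is only used inside expressions that are
  \<open>2\<pi>\<close>-periodic in it, so that the choice is immaterial.\<close>

definition rep :: "real set \<Rightarrow> real" where
  "rep a = (SOME x. x \<in> a)"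

lemma rep_cong: "[rep (angle_class x) = x] (rmod (2 * pi))"
proof -
  have "x \<in> angle_class x" by (simp add: angle_class_def)
  then have "rep (angle_class x) \<in> angle_class x"
    unfolding rep_def by (rule someI)
  then show ?thesis by (simp add: angle_class_def rcong_sym)
qed

text \<open>The derivative of a curve in \<open>\<real>/2\<pi>\<int>\<close> is that of a real-valued lift. The lift \<open>\<phi>\<close> may depend
  on \<open>t\<close> and need not be continuous away from \<open>t\<close>; near \<open>t\<close> differentiability pins it down up to
  a constant in \<open>2\<pi>\<int>\<close>.\<close>

definition has_angle_derivative :: "(real \<Rightarrow> real set) \<Rightarrow> real \<Rightarrow> real \<Rightarrow> real set \<Rightarrow> bool" where
  "has_angle_derivative c v t T \<longleftrightarrow>
     (\<exists>\<phi>. (\<forall>s\<in>T. angle_class (\<phi> s) = c s) \<and> (\<phi> has_real_derivative v) (at t within T))"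

definition torus_solution ::
  "nat \<Rightarrow> ((nat \<Rightarrow> real set) \<Rightarrow> nat \<Rightarrow> real) \<Rightarrow> (real \<Rightarrow> nat \<Rightarrow> real set) \<Rightarrow> bool" where
  "torus_solution N F \<theta> \<longleftrightarrow>
     (\<forall>t\<ge>0. \<theta> t \<in> topspace (torus N)) \<and>
     (\<forall>t\<ge>0. \<forall>i\<in>{1..N}. has_angle_derivative (\<lambda>s. \<theta> s i) (F (\<theta> t) i) t {0..})"

definition set_neighborhood :: "'a topology \<Rightarrow> 'a set \<Rightarrow> 'a set \<Rightarrow> bool" where
  "set_neighborhood X S V \<longleftrightarrow> V \<subseteq> topspace X \<and> (\<exists>U. openin X U \<and> S \<subseteq> U \<and> U \<subseteq> V)"

definition lyapunov_stable ::
  "nat \<Rightarrow> ((nat \<Rightarrow> real set) \<Rightarrow> nat \<Rightarrow> real) \<Rightarrow> (nat \<Rightarrow> real set) set \<Rightarrow> bool" where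
  "lyapunov_stable N F S \<longleftrightarrow>
     (\<forall>V. set_neighborhood (torus N) S V \<longrightarrow>
       (\<exists>W. set_neighborhood (torus N) S W \<and>
         (\<forall>\<theta>. torus_solution N F \<theta> \<and> \<theta> 0 \<in> W \<longrightarrow> (\<forall>t\<ge>0. \<theta> t \<in> V))))"

definition order_parameter :: "nat \<Rightarrow> (nat \<Rightarrow> real set) \<Rightarrow> real" where
  "order_parameter N \<theta> = cmod ((1 / of_nat N) * (\<Sum>i=1..N. exp (\<i> * of_real (rep (\<theta> i)))))"

definition neighbors :: "'a pair_pre_digraph \<Rightarrow> 'a \<Rightarrow> 'a set" where
  "neighbors A i = {j. (i, j) \<in> parcs A}"

definition max_degree :: "'a pair_pre_digraph \<Rightarrow> nat" where
  "max_degree A = Max ((\<lambda>i. card (neighbors A i)) ` pverts A)"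

definition local_field :: "nat pair_pre_digraph \<Rightarrow> (nat \<Rightarrow> real set) \<Rightarrow> nat \<Rightarrow> real" where
  "local_field A \<theta> i = cmod (\<Sum>j\<in>neighbors A i. exp (\<i> * of_real (rep (\<theta> j))))"

definition oscillator_field ::
  "nat pair_pre_digraph \<Rightarrow> real \<Rightarrow> (nat \<Rightarrow> real set) \<Rightarrow> nat \<Rightarrow> real" where
  "oscillator_field A \<epsilon> \<theta> i =
     (1 - \<epsilon> * (local_field A \<theta> i)\<^sup>2) * (\<Sum>j\<in>neighbors A i. sin (rep (\<theta> j) - rep (\<theta> i)))"

end

(* The coupling coefficients 1 - \<epsilon> Z_i^2 are positive because Z_i <= d_max. As long as the phases lie
   close together, a pair (i, j) at maximal distance, that is with cos(\<theta>_i - \<theta>_j) minimal, encloses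
   all other phases, so both its members are pulled inwards and cos(\<theta>_i - \<theta>_j) does not decrease.
   Hence the minimum of these cosines never drops below a nonnegative level that it exceeds at time 0.
   By compactness of the torus the sets where this minimum is close to 1 form a neighborhood
   basis of the synchronized state. Working with cosines avoids global lifts of solutions. *)

theory Submission
  imports Defs
begin

section \<open>A barrier principle\<close>

text \<open>The level \<open>c\<close> is replaced by a barrier sinking linearly to
  \<open>c\<close>, which it reaches at time \<open>T\<close>. At the first contact the touching
  function is minimal and at least \<open>c\<close>, so its derivative is nonnegative while the
  barrier sinks. The gap is then negative just before, contradicting that this contact is the
  first.\<close>

lemma minimum_stays_above_level:
  fixes g g' :: "'p \<Rightarrow> real \<Rightarrow> real"
  assumes "finite P"
    and der: "\<And>p t. p \<in> P \<Longrightarrow> t \<ge> 0 \<Longrightarrow> (g p has_real_derivative g' p t) (at t within {0..})"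
    and nondecr: "\<And>p t. p \<in> P \<Longrightarrow> t \<ge> 0 \<Longrightarrow> g p t \<ge> c \<Longrightarrow> (\<And>q. q \<in> P \<Longrightarrow> g p t \<le> g q t)
                    \<Longrightarrow> g' p t \<ge> 0"
    and init: "\<And>p. p \<in> P \<Longrightarrow> g p 0 > c"
    and "p \<in> P" and "T \<ge> 0"
  shows "g p T \<ge> c"
proof (rule ccontr)
  assume "\<not> g p T \<ge> c"
  then have less: "g p T < c" by simp
  define m where "m = Min ((\<lambda>p. g p 0) ` P)"
  have m_le: "m \<le> g q 0" if "q \<in> P" for q
    unfolding m_def using \<open>finite P\<close> that by (intro Min_le) auto
  have "m \<in> (\<lambda>p. g p 0) ` P"
    unfolding m_def using \<open>finite P\<close> \<open>p \<in> P\<close> by (intro Min_in) auto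
  with init have "m > c" by auto
  \<comment> \<open>The sinking barrier makes the first contact strict, since \<open>g'\<close> is only known to be nonnegative.\<close>
  define \<eta> where "\<eta> = (m - c) / (2 * (T + 1))"
  have "\<eta> > 0" using \<open>m > c\<close> \<open>T \<ge> 0\<close> by (simp add: \<eta>_def)
  have "\<eta> * T \<le> \<eta> * (T + 1)" using \<open>\<eta> > 0\<close> by simp
  also have "\<dots> = (m - c) / 2" using \<open>T \<ge> 0\<close> by (simp add: \<eta>_def field_simps)
  also have "\<dots> < m - c" using \<open>m > c\<close> by simp
  finally have \<eta>: "\<eta> * T < m - c" .
  \<comment> \<open>\<open>f\<close> is the gap above the barrier, which starts below
    \<open>m\<close> and equals \<open>c\<close> at time \<open>T\<close>.\<close>
  define f where "f = (\<lambda>q s. g q s - (c + \<eta> * (T - s)))"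
  have f_der: "(f q has_real_derivative g' q t + \<eta>) (at t within {0..})" if "q \<in> P" "t \<ge> 0" for q t
    unfolding f_def by (rule derivative_eq_intros der that refl)+ simp
  have f_cont: "continuous_on {0..T} (f q)" if "q \<in> P" for q
  proof (rule continuous_on_subset[of "{0..}"])
    show "continuous_on {0..} (f q)"
      unfolding continuous_on_eq_continuous_within
      using f_der[OF that] by (auto intro: DERIV_continuous)
  qed auto
  \<comment> \<open>Contact times. Finiteness of \<open>P\<close> makes this set closed, so there is
    a first one, \<open>\<tau>\<close>.\<close>
  define B where "B = (\<Union>q\<in>P. {s \<in> {0..T}. f q s \<le> 0})"
  have "closed B"
    unfolding B_def
  proof (rule closed_UN[OF \<open>finite P\<close>], rule ballI)
    fix q assume "q \<in> P"
    show "closed {s \<in> {0..T}. f q s \<le> 0}"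
      using continuous_closed_preimage[OF f_cont[OF \<open>q \<in> P\<close>], of "{..0}"]
      by (simp add: vimage_def Collect_conj_eq[symmetric] Int_def)
  qed
  moreover have B_sub: "B \<subseteq> {0..T}" by (auto simp: B_def)
  then have bdd: "bdd_below B" by (meson bdd_below_Icc bdd_below_mono)
  moreover have "T \<in> B"
    using \<open>p \<in> P\<close> \<open>T \<ge> 0\<close> less by (auto simp: B_def f_def intro!: bexI[of _ p])
  ultimately have "Inf B \<in> B" by (intro closed_contains_Inf) auto
  define \<tau> where "\<tau> = Inf B"
  obtain q where q: "q \<in> P" "0 \<le> \<tau>" "\<tau> \<le> T" "f q \<tau> \<le> 0"
    using \<open>Inf B \<in> B\<close> by (auto simp: B_def \<tau>_def)
  have before: "f r s > 0" if "r \<in> P" "0 \<le> s" "s < \<tau>" for r s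
  proof (rule ccontr)
    assume "\<not> f r s > 0"
    then have "f r s \<le> 0" by simp
    then have "s \<in> B" using that q(3) unfolding B_def by fastforce
    then show False using cInf_lower[OF _ bdd, of s] that by (simp add: \<tau>_def)
  qed
  have f0: "f r 0 > 0" if "r \<in> P" for r
    using m_le[OF that] \<eta> by (simp add: f_def)
  have "\<tau> > 0" using f0[OF \<open>q \<in> P\<close>] q by (cases "\<tau> = 0") auto
  \<comment> \<open>A negative gap would have vanished earlier, by the intermediate value theorem.
    As all gaps share one barrier, a gap vanishing at \<open>\<tau>\<close> belongs to a minimal
    \<open>g r\<close>.\<close>
  have at_\<tau>: "f r \<tau> \<ge> 0" if r: "r \<in> P" for r
  proof (rule ccontr)
    assume "\<not> f r \<tau> \<ge> 0"
    then have neg: "f r \<tau> < 0" by simp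
    have "continuous_on {0..\<tau>} (f r)"
      using f_cont[OF r] by (rule continuous_on_subset) (use q in auto)
    then obtain s where s: "0 \<le> s" "s \<le> \<tau>" "f r s = 0"
      using IVT2'[of "f r" \<tau> 0 0] neg f0[OF r] \<open>\<tau> > 0\<close> by auto
    then show False using before[OF r, of s] neg by (cases "s = \<tau>") auto
  qed
  have "f q \<tau> = 0" using at_\<tau>[OF q(1)] q by simp
  then have gq: "g q \<tau> = c + \<eta> * (T - \<tau>)" by (simp add: f_def)
  have "g' q \<tau> \<ge> 0"
  proof (rule nondecr[OF q(1,2)])
    show "g q \<tau> \<ge> c" using gq \<open>\<eta> > 0\<close> q by simp
    show "g q \<tau> \<le> g r \<tau>" if "r \<in> P" for r
      using at_\<tau>[OF that] gq by (simp add: f_def)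
  qed
  then obtain d where "d > 0"
    and d: "\<And>h. h > 0 \<Longrightarrow> \<tau> - h \<in> {0..} \<Longrightarrow> h < d \<Longrightarrow> f q (\<tau> - h) < f q \<tau>"
    using has_real_derivative_pos_inc_left[OF f_der[OF q(1,2)]] \<open>\<eta> > 0\<close> by force
  \<comment> \<open>Halving \<open>d\<close> gives \<open>h < d\<close>; the bound by
    \<open>\<tau>\<close> keeps \<open>\<tau> - h\<close> nonnegative.\<close>
  define h where "h = min (d / 2) \<tau>"
  have h: "h > 0" "\<tau> - h \<in> {0..}" "h < d"
    using \<open>d > 0\<close> \<open>\<tau> > 0\<close> by (auto simp: h_def)
  show False
    using d[OF h] before[OF q(1), of "\<tau> - h"] h \<open>f q \<tau> = 0\<close> by auto
qed

section \<open>Angles\<close>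

lemma angle_class_eq_iff: "angle_class x = angle_class y \<longleftrightarrow> [x = y] (rmod (2 * pi))"
  unfolding angle_class_def by (auto intro: rcong_sym rcong_trans)

text \<open>Lets equality of phases be tested by a continuous periodic function instead of by
  lifts.\<close>

lemma rcong_2pi_iff_cos_diff: "[x = y] (rmod (2 * pi)) \<longleftrightarrow> cos (x - y) = 1"
  unfolding cos_one_2pi_int rcong_altdef
proof
  assume "\<exists>n. y = x + of_int n * (2 * pi)"
  then obtain n where "y = x + of_int n * (2 * pi)" by blast
  then show "\<exists>n::int. x - y = of_int n * 2 * pi" by (intro exI[of _ "- n"]) simp
next
  assume "\<exists>n::int. x - y = of_int n * 2 * pi"
  then obtain n :: int where "x - y = of_int n * 2 * pi" by blast
  then show "\<exists>n. y = x + of_int n * (2 * pi)"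
    by (intro exI[of _ "- n"]) (simp add: algebra_simps)
qed

lemma cos_sin_rep_angle_class:
  "cos (rep (angle_class x)) = cos x" "sin (rep (angle_class x)) = sin x"
proof -
  obtain n where x: "x = rep (angle_class x) + of_int n * (2 * pi)"
    using rep_cong[of x] unfolding rcong_altdef by blast
  \<comment> \<open>The fact \<open>x\<close> rewrites \<open>x\<close> to a term containing
    \<open>x\<close>; naming the representative breaks the loop.\<close>
  define y where "y = rep (angle_class x)"
  have "x = y + of_int n * (2 * pi)" using x unfolding y_def .
  then have "cos y = cos x" "sin y = sin x"
    by (simp_all add: cos_add sin_add mult.commute[of _ "2 * pi"])
  then show "cos (rep (angle_class x)) = cos x" "sin (rep (angle_class x)) = sin x"
    by (simp_all add: y_def)
qed

lemma topspace_circle: "topspace circle = range angle_class"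
  using quotient_imp_surjective_map[OF quotient_map_angle_class] by simp

lemma eq_iff_cos_rep_diff:
  assumes "a \<in> topspace circle" "b \<in> topspace circle"
  shows "a = b \<longleftrightarrow> cos (rep a - rep b) = 1"
proof -
  obtain x y where "a = angle_class x" "b = angle_class y"
    using assms by (auto simp: topspace_circle)
  then show ?thesis
    by (simp add: angle_class_eq_iff rcong_2pi_iff_cos_diff cos_diff cos_sin_rep_angle_class)
qed

text \<open>Reduction modulo 2 pi shows that the circle is the continuous image of a compact
  interval.\<close>

lemma compact_space_circle: "compact_space circle"
proof -
  have "x \<in> range angle_class \<Longrightarrow> x \<in> angle_class ` {0..2 * pi}" for x
  proof -
    assume "x \<in> range angle_class"
    then obtain y where "x = angle_class y" by blast
    also have "\<dots> = angle_class (y rmod (2 * pi))"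
      by (simp add: angle_class_eq_iff)
    finally show "x \<in> angle_class ` {0..2 * pi}"
      using rmod_nonneg[of "2 * pi" y] rmod_less[of "2 * pi" y] by auto
  qed
  then have "topspace circle = angle_class ` {0..2 * pi}"
    by (auto simp: topspace_circle)
  then show ?thesis
    unfolding compact_space_def
    using image_compactin[of euclideanreal "{0..2 * pi}" circle angle_class]
      quotient_imp_continuous_map[OF quotient_map_angle_class] by simp
qed

lemma compact_space_torus: "compact_space (torus N)"
  by (simp add: torus_def compact_space_product_topology compact_space_circle)

lemma topspace_torusD: "\<theta> \<in> topspace (torus N) \<Longrightarrow> i \<in> {1..N} \<Longrightarrow> \<theta> i \<in> topspace circle"
  by (auto simp: torus_def)

text \<open>\<open>rep\<close> is an arbitrary choice, but the addition formula leaves only sines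
  and cosines of single coordinates, and these descend continuously to the quotient.\<close>

lemma continuous_map_cos_diff:
  assumes "i \<in> {1..N}" "j \<in> {1..N}"
  shows "continuous_map (torus N) euclideanreal (\<lambda>\<theta>. cos (rep (\<theta> i) - rep (\<theta> j)))"
proof -
  have "continuous_map circle euclideanreal (\<lambda>a. cos (rep a))"
    "continuous_map circle euclideanreal (\<lambda>a. sin (rep a))"
    by (rule continuous_compose_quotient_map[OF quotient_map_angle_class],
        simp add: o_def cos_sin_rep_angle_class continuous_intros)+
  then have "continuous_map (torus N) euclideanreal (\<lambda>\<theta>. cos (rep (\<theta> k)))"
    "continuous_map (torus N) euclideanreal (\<lambda>\<theta>. sin (rep (\<theta> k)))" if "k \<in> {1..N}" for k
    using continuous_map_compose[OF continuous_map_product_projection[OF that, of "\<lambda>_. circle"]]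
    by (auto simp: torus_def o_def)
  with assms show ?thesis
    unfolding cos_diff by (intro continuous_map_add continuous_map_real_mult) auto
qed

section \<open>The synchronized state\<close>

lemma norm_sum_cis_squared:
  fixes x :: "'a \<Rightarrow> real"
  shows "(cmod (\<Sum>i\<in>I. exp (\<i> * of_real (x i))))\<^sup>2 = (\<Sum>i\<in>I. \<Sum>j\<in>I. cos (x i - x j))"
proof -
  have "(cmod (\<Sum>i\<in>I. exp (\<i> * of_real (x i))))\<^sup>2 = (\<Sum>i\<in>I. cos (x i))\<^sup>2 + (\<Sum>i\<in>I. sin (x i))\<^sup>2"
    by (simp add: cmod_power2 Re_exp Im_exp)
  also have "\<dots> = (\<Sum>i\<in>I. \<Sum>j\<in>I. cos (x i - x j))"
    by (simp add: power2_eq_square sum_product cos_diff sum.distrib)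
  finally show ?thesis .
qed

lemma sum_cos_defect_eq_0_iff:
  fixes x :: "'a \<Rightarrow> real"
  assumes "finite I"
  shows "(\<Sum>i\<in>I. \<Sum>j\<in>I. 1 - cos (x i - x j)) = 0 \<longleftrightarrow> (\<forall>i\<in>I. \<forall>j\<in>I. cos (x i - x j) = 1)"
  using assms by (auto simp: sum_nonneg_eq_0_iff sum_nonneg)

text \<open>The squared norm of the sum of phasors is the sum of the cosines over all N^2 ordered
  pairs. It equals N^2 exactly when every cosine attains its maximum 1.\<close>

lemma order_parameter_eq_1_iff:
  assumes "N \<ge> 1" "\<theta> \<in> topspace (torus N)"
  shows "order_parameter N \<theta> = 1 \<longleftrightarrow> (\<forall>i\<in>{1..N}. \<forall>j\<in>{1..N}. \<theta> i = \<theta> j)"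
proof -
  define S where "S = cmod (\<Sum>i=1..N. exp (\<i> * of_real (rep (\<theta> i))))"
  have "S \<ge> 0" by (simp add: S_def)
  have "order_parameter N \<theta> = S / N"
    by (simp add: order_parameter_def norm_mult norm_divide S_def)
  then have "order_parameter N \<theta> = 1 \<longleftrightarrow> S = N"
    using \<open>N \<ge> 1\<close> by (auto simp: field_simps)
  also have "\<dots> \<longleftrightarrow> S\<^sup>2 = (real N)\<^sup>2"
    using \<open>S \<ge> 0\<close> by (simp add: power2_eq_iff_nonneg)
  also have "\<dots> \<longleftrightarrow> (\<Sum>i=1..N. \<Sum>j=1..N. 1 - cos (rep (\<theta> i) - rep (\<theta> j))) = 0"
    unfolding S_def norm_sum_cis_squared by (auto simp: sum_subtractf power2_eq_square)
  also have "\<dots> \<longleftrightarrow> (\<forall>i\<in>{1..N}. \<forall>j\<in>{1..N}. cos (rep (\<theta> i) - rep (\<theta> j)) = 1)"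
    by (rule sum_cos_defect_eq_0_iff) simp
  also have "\<dots> \<longleftrightarrow> (\<forall>i\<in>{1..N}. \<forall>j\<in>{1..N}. \<theta> i = \<theta> j)"
    using eq_iff_cos_rep_diff topspace_torusD[OF assms(2)] by blast
  finally show ?thesis .
qed

text \<open>The total defect \<open>H\<close> vanishes only at synchronization, so on the compact
  complement of \<open>U\<close> it has a positive lower bound \<open>h\<close>. Cosines close
  enough to 1 force \<open>H\<close> below \<open>h\<close>.\<close>

lemma cosine_neighborhoods:
  assumes "openin (torus N) U"
    and sync: "{\<theta> \<in> topspace (torus N). \<forall>i\<in>{1..N}. \<forall>j\<in>{1..N}. \<theta> i = \<theta> j} \<subseteq> U"
  obtains c where "0 \<le> c" "c < 1"
    and "\<And>\<theta>. \<theta> \<in> topspace (torus N) \<Longrightarrow>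
           (\<And>i j. i \<in> {1..N} \<Longrightarrow> j \<in> {1..N} \<Longrightarrow> c \<le> cos (rep (\<theta> i) - rep (\<theta> j))) \<Longrightarrow> \<theta> \<in> U"
proof -
  define H where "H = (\<lambda>\<theta>::nat \<Rightarrow> real set. \<Sum>i=1..N. \<Sum>j=1..N. 1 - cos (rep (\<theta> i) - rep (\<theta> j)))"
  define K where "K = topspace (torus N) - U"
  have "continuous_map (torus N) euclideanreal H"
    unfolding H_def
    by (intro continuous_map_sum continuous_map_diff continuous_map_cos_diff) auto
  moreover have "compactin (torus N) K"
    unfolding K_def using assms(1) by (intro closedin_compact_space compact_space_torus) auto
  ultimately have compact: "compact (H ` K)"
    using image_compactin compactin_euclidean_iff by blast
  have pos: "H \<theta> > 0" if "\<theta> \<in> K" for \<theta>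
  proof -
    have "\<theta> \<in> topspace (torus N)" "\<theta> \<notin> U" using that by (auto simp: K_def)
    then have "\<not> (\<forall>i\<in>{1..N}. \<forall>j\<in>{1..N}. cos (rep (\<theta> i) - rep (\<theta> j)) = 1)"
      using sync eq_iff_cos_rep_diff topspace_torusD[of \<theta> N] by blast
    then have "H \<theta> \<noteq> 0"
      unfolding H_def by (subst sum_cos_defect_eq_0_iff) auto
    moreover have "H \<theta> \<ge> 0" unfolding H_def by (intro sum_nonneg) simp
    ultimately show ?thesis by simp
  qed
  obtain h where h: "h > 0" "\<And>\<theta>. \<theta> \<in> K \<Longrightarrow> h \<le> H \<theta>"
  proof (cases "K = {}")
    case False
    then obtain \<theta>0 where "\<theta>0 \<in> K" "\<forall>\<theta>\<in>K. H \<theta>0 \<le> H \<theta>"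
      using compact_attains_inf[OF compact] by auto
    then show ?thesis using pos by (intro that[of "H \<theta>0"]) auto
  qed (use that[of 1] in auto)
  \<comment> \<open>There are N^2 defects of at most \<open>\<delta>\<close> each. The summand 1
    keeps \<open>M\<close> positive for \<open>N = 0\<close>, the factor 2 below makes the bound
    strict, and the cap at 1 yields a nonnegative level.\<close>
  define M where "M = real N * real N + 1"
  have "M > 0" by (simp add: M_def add_nonneg_pos)
  define \<delta> where "\<delta> = min 1 (h / (2 * M))"
  have "\<delta> > 0" using h(1) \<open>M > 0\<close> by (simp add: \<delta>_def)
  have "real N * real N * \<delta> \<le> M * (h / (2 * M))"
    using \<open>\<delta> > 0\<close> by (intro mult_mono) (auto simp: \<delta>_def M_def)
  also have "\<dots> = h / 2" using \<open>M > 0\<close> by simp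
  also have "\<dots> < h" using h(1) by simp
  finally have \<delta>: "real N * real N * \<delta> < h" .
  show ?thesis
  proof (rule that[of "1 - \<delta>"])
    show "0 \<le> 1 - \<delta>" "1 - \<delta> < 1" using \<open>\<delta> > 0\<close> by (auto simp: \<delta>_def)
    fix \<theta>
    assume \<theta>: "\<theta> \<in> topspace (torus N)"
      and near: "\<And>i j. i \<in> {1..N} \<Longrightarrow> j \<in> {1..N} \<Longrightarrow> 1 - \<delta> \<le> cos (rep (\<theta> i) - rep (\<theta> j))"
    have "H \<theta> \<le> (\<Sum>i=1..N. \<Sum>j=1..N. \<delta>)"
      unfolding H_def by (intro sum_mono) (use near in force)
    then have "H \<theta> < h" using \<delta> by simp
    then show "\<theta> \<in> U" using h(2)[of \<theta>] \<theta> by (force simp: K_def)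
  qed
qed

lemma openin_cosine_neighborhood:
  "openin (torus N) {\<theta> \<in> topspace (torus N). \<forall>i\<in>{1..N}. \<forall>j\<in>{1..N}. c < cos (rep (\<theta> i) - rep (\<theta> j))}"
    (is "openin _ ?W")
\<comment> \<open>With no pairs, the indexed intersection used below would be the whole type instead
  of the torus.\<close>
proof (cases "N = 0")
  case False
  define P where "P = {1..N} \<times> {1..N}"
  have P: "finite P" "P \<noteq> {}" using False by (auto simp: P_def)
  have "openin (torus N) (\<Inter>p\<in>P. {\<theta> \<in> topspace (torus N).
          cos (rep (\<theta> (fst p)) - rep (\<theta> (snd p))) \<in> {c<..}})"
    using P by (intro openin_INT2 openin_continuous_map_preimage[OF continuous_map_cos_diff])
      (auto simp: P_def)
  also have "\<dots> = ?W" using False by (fastforce simp: P_def)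
  finally show ?thesis .
qed simp

section \<open>Dynamics\<close>

text \<open>The cosine of a difference does not depend on the representatives, so the chain rule may
  be applied to whatever lifts witness the derivatives at \<open>t\<close>.\<close>

lemma derivative_cos_diff:
  assumes "has_angle_derivative a u t {0..}" "has_angle_derivative b v t {0..}" "t \<ge> 0"
  shows "((\<lambda>s. cos (rep (a s) - rep (b s))) has_real_derivative
           - sin (rep (a t) - rep (b t)) * (u - v)) (at t within {0..})"
proof -
  obtain \<phi> \<psi> where lift: "\<And>s. s \<ge> 0 \<Longrightarrow> a s = angle_class (\<phi> s)" "\<And>s. s \<ge> 0 \<Longrightarrow> b s = angle_class (\<psi> s)"
    and [derivative_intros]: "(\<phi> has_real_derivative u) (at t within {0..})"
      "(\<psi> has_real_derivative v) (at t within {0..})"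
    using assms(1,2) unfolding has_angle_derivative_def by (metis atLeast_iff)
  have cos_eq: "cos (\<phi> s - \<psi> s) = cos (rep (a s) - rep (b s))"
    and sin_eq: "sin (\<phi> s - \<psi> s) = sin (rep (a s) - rep (b s))" if "s \<ge> 0" for s
    using that by (simp_all add: lift cos_diff sin_diff cos_sin_rep_angle_class)
  have "((\<lambda>s. cos (\<phi> s - \<psi> s)) has_real_derivative - sin (\<phi> t - \<psi> t) * (u - v)) (at t within {0..})"
    by (auto intro!: derivative_eq_intros)
  then show ?thesis
    unfolding sin_eq[OF \<open>t \<ge> 0\<close>]
    by (rule has_field_derivative_transform_within[where d = 1]) (use \<open>t \<ge> 0\<close> cos_eq in auto)
qed

text \<open>Here \<open>x\<close> and \<open>y\<close> are the extremal phases and \<open>z\<close>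
  pulls on \<open>x\<close>. Splitting \<open>z - y\<close> as \<open>(x - y) + (z - x)\<close>
  bounds the product by \<open>cos (x - y) * (cos (z - x) - 1)\<close>.\<close>

lemma extremal_pair_pulled_inwards:
  fixes x y z :: real
  assumes "cos (x - y) \<ge> 0" and "cos (x - y) \<le> cos (z - y)"
  shows "sin (x - y) * sin (z - x) \<le> 0"
proof -
  have "cos (z - y) = cos ((x - y) + (z - x))" by simp
  also have "\<dots> = cos (x - y) * cos (z - x) - sin (x - y) * sin (z - x)" by (rule cos_add)
  finally have "sin (x - y) * sin (z - x) \<le> cos (x - y) * (cos (z - x) - 1)"
    using assms(2) by (simp add: algebra_simps)
  also have "\<dots> \<le> 0" using assms(1) by (simp add: mult_nonneg_nonpos)
  finally show ?thesis .
qed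

lemma local_field_le_degree: "local_field A \<theta> i \<le> card (neighbors A i)"
proof -
  have "local_field A \<theta> i \<le> (\<Sum>j\<in>neighbors A i. cmod (exp (\<i> * of_real (rep (\<theta> j)))))"
    unfolding local_field_def by (rule norm_sum)
  then show ?thesis by simp
qed

text \<open>By the triangle inequality the local field is at most the degree, hence at most
  \<open>max_degree A\<close>.\<close>

lemma coupling_coefficient_nonneg:
  assumes "finite (pverts A)" "i \<in> pverts A" "\<epsilon> \<ge> 0" "\<epsilon> < 1 / (real (max_degree A))\<^sup>2"
  shows "1 - \<epsilon> * (local_field A \<theta> i)\<^sup>2 \<ge> 0"
proof -
  have "card (neighbors A i) \<le> max_degree A"
    unfolding max_degree_def using assms by (intro Max_ge) auto
  then have "local_field A \<theta> i \<le> max_degree A"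
    using local_field_le_degree[of A \<theta> i] by linarith
  moreover have "local_field A \<theta> i \<ge> 0" by (simp add: local_field_def)
  ultimately have "(local_field A \<theta> i)\<^sup>2 \<le> (real (max_degree A))\<^sup>2"
    by (intro power_mono) auto
  then have "\<epsilon> * (local_field A \<theta> i)\<^sup>2 \<le> \<epsilon> * (real (max_degree A))\<^sup>2"
    using assms by (intro mult_left_mono)
  \<comment> \<open>If \<open>max_degree A = 0\<close>, the bound on \<open>\<epsilon>\<close> reads \<open>\<epsilon> < 1 / 0 = 0\<close>.\<close>
  moreover have "\<epsilon> * (real (max_degree A))\<^sup>2 \<le> 1"
    using assms by (cases "max_degree A = 0") (auto simp: field_simps)
  ultimately show ?thesis by simp
qed

text \<open>Each neighbor's pull has the right sign, and all of them share one nonnegative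
  coefficient.\<close>

lemma oscillator_field_inwards:
  assumes "1 - \<epsilon> * (local_field A \<theta> i)\<^sup>2 \<ge> 0"
    and "cos (rep (\<theta> i) - rep (\<theta> j)) \<ge> 0"
    and "\<And>k. k \<in> neighbors A i \<Longrightarrow> cos (rep (\<theta> i) - rep (\<theta> j)) \<le> cos (rep (\<theta> k) - rep (\<theta> j))"
  shows "sin (rep (\<theta> i) - rep (\<theta> j)) * oscillator_field A \<epsilon> \<theta> i \<le> 0"
proof -
  have "sin (rep (\<theta> i) - rep (\<theta> j)) * (\<Sum>k\<in>neighbors A i. sin (rep (\<theta> k) - rep (\<theta> i))) \<le> 0"
    unfolding sum_distrib_left
    by (intro sum_nonpos extremal_pair_pulled_inwards assms)
  with assms(1) show ?thesis
    unfolding oscillator_field_def by (subst mult.left_commute) (rule mult_nonneg_nonpos)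
qed

text \<open>The barrier principle is applied to the cosines of all ordered pairs;
  \<open>c \<ge> 0\<close> keeps a minimal pair within a quarter turn, where the inward pull
  holds.\<close>

lemma cosines_stay_above_level:
  assumes "pverts A = {1..N}" and nbrs: "\<And>i. neighbors A i \<subseteq> {1..N}"
    and "\<epsilon> \<ge> 0" "\<epsilon> < 1 / (real (max_degree A))\<^sup>2"
    and sol: "torus_solution N (oscillator_field A \<epsilon>) \<theta>"
    and "c \<ge> 0"
    and init: "\<And>i j. i \<in> {1..N} \<Longrightarrow> j \<in> {1..N} \<Longrightarrow> c < cos (rep (\<theta> 0 i) - rep (\<theta> 0 j))"
    and "i \<in> {1..N}" "j \<in> {1..N}" "t \<ge> 0"
  shows "c \<le> cos (rep (\<theta> t i) - rep (\<theta> t j))"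
proof -
  define P where "P = {1..N} \<times> {1..N}"
  define F where "F = (\<lambda>t i. oscillator_field A \<epsilon> (\<theta> t) i)"
  define g where "g = (\<lambda>(i, j) t. cos (rep (\<theta> t i) - rep (\<theta> t j)))"
  define g' where "g' = (\<lambda>(i, j) t. - sin (rep (\<theta> t i) - rep (\<theta> t j)) * (F t i - F t j))"
  have g_sym: "g (k, l) s = g (l, k) s" for k l s
    unfolding g_def prod.case by (metis cos_minus minus_diff_eq)
  have "c \<le> g (i, j) t"
  proof (rule minimum_stays_above_level[of P g g' c "(i, j)" t])
    fix p and t :: real
    assume p: "p \<in> P" and t: "t \<ge> 0"
    obtain k l where kl: "p = (k, l)" "k \<in> {1..N}" "l \<in> {1..N}" using p by (auto simp: P_def)
    have "has_angle_derivative (\<lambda>s. \<theta> s k) (F t k) t {0..}"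
      "has_angle_derivative (\<lambda>s. \<theta> s l) (F t l) t {0..}"
      using sol t kl unfolding torus_solution_def F_def by blast+
    from derivative_cos_diff[OF this t]
    show "(g p has_real_derivative g' p t) (at t within {0..})"
      by (simp add: g_def g'_def kl)
    assume above: "g p t \<ge> c" and least: "\<And>q. q \<in> P \<Longrightarrow> g p t \<le> g q t"
    \<comment> \<open>Stated for ordered pairs so that, by symmetry of the cosine, it serves both
      ends of the minimal pair.\<close>
    have inwards: "sin (rep (\<theta> t a) - rep (\<theta> t b)) * F t a \<le> 0"
      if ab: "a \<in> {1..N}" "b \<in> {1..N}" "g (a, b) t = g p t" for a b
      unfolding F_def
    proof (rule oscillator_field_inwards)
      show "1 - \<epsilon> * (local_field A (\<theta> t) a)\<^sup>2 \<ge> 0"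
        using assms ab by (intro coupling_coefficient_nonneg) auto
      show "cos (rep (\<theta> t a) - rep (\<theta> t b)) \<ge> 0"
        using ab(3) above \<open>c \<ge> 0\<close> by (simp add: g_def)
      fix m assume "m \<in> neighbors A a"
      \<comment> \<open>Replacing \<open>a\<close> by its neighbor gives another pair, to which
        minimality applies.\<close>
      then have "(m, b) \<in> P" using nbrs[of a] ab(2) unfolding P_def by blast
      from least[OF this]
      show "cos (rep (\<theta> t a) - rep (\<theta> t b)) \<le> cos (rep (\<theta> t m) - rep (\<theta> t b))"
        using ab(3) by (simp add: g_def)
    qed
    have "sin (rep (\<theta> t l) - rep (\<theta> t k)) = - sin (rep (\<theta> t k) - rep (\<theta> t l))"
      by (metis sin_minus minus_diff_eq)
    then show "g' p t \<ge> 0"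
      using inwards[of k l] inwards[of l k] kl g_sym[of k l t]
      by (simp add: g'_def algebra_simps)
  qed (use assms in \<open>auto simp: P_def g_def\<close>)
  then show ?thesis by (simp add: g_def)
qed

theorem theorem1:
  fixes N :: nat and A :: "nat pair_pre_digraph" and \<epsilon> :: real
  assumes "N \<ge> 2"
    and "pair_graph A" and "pverts A = {1..N}"
    and "Digraph_Component.connected (with_proj A)"
    and "\<epsilon> \<ge> 0" and "\<epsilon> < 1 / (real (max_degree A))\<^sup>2"
  shows "{\<theta> \<in> topspace (torus N). order_parameter N \<theta> = 1} =
           {\<theta> \<in> topspace (torus N). \<forall>i\<in>{1..N}. \<forall>j\<in>{1..N}. \<theta> i = \<theta> j} \<and>
         lyapunov_stable N (oscillator_field A \<epsilon>)
           {\<theta> \<in> topspace (torus N). order_parameter N \<theta> = 1}"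
proof -
  interpret pair_graph A by fact
  have nbrs: "neighbors A i \<subseteq> {1..N}" for i
    using assms(3) by (auto simp: neighbors_def dest: in_arcsD2)
  define S where "S = {\<theta> \<in> topspace (torus N). \<forall>i\<in>{1..N}. \<forall>j\<in>{1..N}. \<theta> i = \<theta> j}"
  have sync: "{\<theta> \<in> topspace (torus N). order_parameter N \<theta> = 1} = S"
    unfolding S_def using order_parameter_eq_1_iff[of N] assms(1) by auto
  have "lyapunov_stable N (oscillator_field A \<epsilon>) S"
    unfolding lyapunov_stable_def
  proof (intro allI impI)
    fix V assume "set_neighborhood (torus N) S V"
    then obtain U where U: "openin (torus N) U" "S \<subseteq> U" "U \<subseteq> V"
      by (auto simp: set_neighborhood_def)
    from U(2) obtain c where c: "0 \<le> c" "c < 1"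
      "\<And>\<theta>. \<theta> \<in> topspace (torus N) \<Longrightarrow>
         (\<And>i j. i \<in> {1..N} \<Longrightarrow> j \<in> {1..N} \<Longrightarrow> c \<le> cos (rep (\<theta> i) - rep (\<theta> j))) \<Longrightarrow> \<theta> \<in> U"
      unfolding S_def by (rule cosine_neighborhoods[OF U(1)]) blast
    \<comment> \<open>The strict inequality makes \<open>W\<close> open and gives the barrier
      principle its strict initial condition; the weak one preserved in time still implies
      membership in \<open>U\<close>.\<close>
    define W where "W = {\<theta> \<in> topspace (torus N).
      \<forall>i\<in>{1..N}. \<forall>j\<in>{1..N}. c < cos (rep (\<theta> i) - rep (\<theta> j))}"
    have "S \<subseteq> W"
    proof
      fix \<theta> assume "\<theta> \<in> S"
      then have "c < cos (rep (\<theta> i) - rep (\<theta> j))" if "i \<in> {1..N}" "j \<in> {1..N}" for i j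
      proof -
        have "\<theta> i = \<theta> j" using \<open>\<theta> \<in> S\<close> that unfolding S_def by blast
        with c(2) show ?thesis by simp
      qed
      with \<open>\<theta> \<in> S\<close> show "\<theta> \<in> W" unfolding W_def S_def by blast
    qed
    moreover have "openin (torus N) W"
      unfolding W_def by (rule openin_cosine_neighborhood)
    ultimately have "set_neighborhood (torus N) S W"
      unfolding set_neighborhood_def using openin_subset by blast
    moreover have "\<theta> t \<in> V"
      if sol: "torus_solution N (oscillator_field A \<epsilon>) \<theta>" and "\<theta> 0 \<in> W" and "t \<ge> 0" for \<theta> t
    proof -
      have "\<theta> t \<in> topspace (torus N)"
        using sol \<open>t \<ge> 0\<close> by (simp add: torus_solution_def)
      moreover have "c \<le> cos (rep (\<theta> t i) - rep (\<theta> t j))" if "i \<in> {1..N}" "j \<in> {1..N}" for i j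
        using \<open>\<theta> 0 \<in> W\<close> that
        by (intro cosines_stay_above_level[OF assms(3) nbrs assms(5,6) sol c(1) _ _ _ \<open>t \<ge> 0\<close>])
          (auto simp: W_def)
      ultimately show ?thesis using c(3) U(3) by blast
    qed
    ultimately show "\<exists>W. set_neighborhood (torus N) S W \<and>
        (\<forall>\<theta>. torus_solution N (oscillator_field A \<epsilon>) \<theta> \<and> \<theta> 0 \<in> W \<longrightarrow> (\<forall>t\<ge>0. \<theta> t \<in> V))"
      by blast
  qed
  with sync show ?thesis unfolding S_def by simp
qed

end
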